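(* Let $T=(1,2,\ldots,d,t_d,\ldots,t_{\mathsf j},0)$ with $d\ge t_d\ge\cdots\ge t_{\mathsf j}>0$, let $P$ be a partition of diagonal lengths $T$ with difference-one hook code $\mathfrak Q(P)=(\mathfrak h_d(P),\ldots,\mathfrak h_{\mathsf j}(P))$, and let $i\in[d,\mathsf j]$. Then the difference-one hook code of the component partition $P_i$ is exactly the $i$-th component $\mathfrak h_i(P)$ of $\mathfrak Q(P)$.
   Context: Let $R=\mathsf k[x,y]$ with its standard grading over a field $\mathsf k$, $\mathfrak m=(x,y)$. For a partition $P=(p_1\ge\cdots\ge p_m)$ let $C_P$ be the set of monomials $x^ay^b$ with $0\le b<m$, $0\le a<p_{b+1}$ (Ferrers diagram: $x$-degree increases to the right, $y$-degree increases downwards), and $E_P$ the set of monomials not in $C_P$, and also the monomial ideal they generate. The diagonal lengths of $P$ is the Hilbert function of $R/E_P$. Put $t_{d-1}=d$, $t_{\mathsf j+1}=0$, $\delta_i=t_{i-1}-t_i$ for $d\le i\le\mathsf j+1$. Monomials of degree $i$ are ordered $x^i<x^{i-1}y<\cdots<y^i$ (lex; "first", "above" mean smaller $y$-degree). Hook code. A hook of $P$ consists of a corner $c\in C_P$, an arm $c,xc,\ldots,\nu=x^{u-1}c$ and a leg $c,yc,\ldots,\mu=y^{v-1}c$ in $C_P$ with $x\nu\in E_P$, $y\mu\in E_P$; $\nu$ is its hand, $\mu$ its foot, and it is a difference-one hook if $u-v=1$. A degree-$i$ hand monomial is a degree-$i$ monomial $\nu\in C_P$ with $x\nu\in E_P$.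 For $d\le i\le\mathsf j$, $\mathfrak h_i(P)$ is the sequence of $\delta_{i+1}$ integers whose $k$-th entry is the number of difference-one hooks of $P$ whose hand is the $k$-th (lex) degree-$i$ hand monomial; it is a non-increasing sequence with entries in $[0,\delta_i+1]$ (empty if $\delta_{i+1}=0$). The hook code of $P$ is $(\mathfrak h_d(P),\ldots,\mathfrak h_{\mathsf j}(P))$. For a partition with diagonal lengths $(1,2,\ldots,d',t',0)$, the hook code has a single block, in hand-degree $d'$, with $t'$ entries; for $P_i$ this hand-degree is $d_i=\delta_i+\delta_{i+1}$. Component partitions. A monomial $x^ay^b\in E_P$ is a horizontal-border monomial if $b>0$ and $x^ay^{b-1}\notin E_P$; it is a vertical-border monomial if $a>0$ and $x^{a-1}y^b\notin E_P$. $A(P)_i$ is the set of degree-$i$ horizontal-border monomials. For $d\le i\le\mathsf j$: $V_{i1}=A(P)_i$ if $x^i\in C_P$; if $x^i\notin C_P$, $V_{i1}=A(P)_i\cup\{x^ay^b\}$ where $x^ay^b$ is the last (lex) degree-$i$ vertical-border monomial lying above the first (lex) monomial of $A(P)_i$ (the condition "above" being vacuous if $A(P)_i=\emptyset$). $V_{i2}$ is the set of the first (lex) $\delta_{i+1}$ degree-$i$ hand monomials. With $d_i=\delta_i+\delta_{i+1}$, one has $|V_{i1}|=\delta_i+1$, $|V_{i1}\cup V_{i2}|=d_i+1$; let $s_i$ be the unique order-preserving bijection from $V_{i1}\cup V_{i2}$ to the set of degree-$d_i$ monomials of $R$. The component $P_i$ is the unique partition with $E_{P_i}=\langle s_i(V_{i1})\rangle+\mathfrak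 m^{d_i+1}$; its diagonal lengths are $T_i=(1,2,\ldots,d_i,\delta_{i+1},0)$ ($P_i$ is empty if $d_i=0$). *)

theory Defs
  imports Complex_Main "HOL-Library.Poly_Mapping" "HOL-Library.Product_Plus" "HOL-Library.FuncSet"
begin

section \<open>The polynomial ring in two variables\<close>

text \<open>
  The monomial \<open>x^a y^b\<close> is the exponent pair \<open>(a, b)\<close>, and \<open>k[x,y]\<close> is the monoid algebra of
  \<open>nat \<times> nat\<close> (componentwise addition, from \<^theory>\<open>HOL-Library.Product_Plus\<close>) over \<open>'k\<close>.
\<close>

type_synonym monom2 = "nat \<times> nat"
type_synonym 'k poly2 = "(nat \<times> nat) \<Rightarrow>\<^sub>0 'k"

definition deg :: "monom2 \<Rightarrow> nat" where
  "deg m = fst m + snd m"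

definition monoms :: "nat \<Rightarrow> monom2 set" where
  "monoms i = {m. deg m = i}"

text \<open>
  The order \<open>x^i < x^(i-1) y < \<dots> < y^i\<close>; it is only ever used to compare monomials of the same
  degree.
\<close>

definition lex_less :: "monom2 \<Rightarrow> monom2 \<Rightarrow> bool" where
  "lex_less m n \<longleftrightarrow> snd m < snd n"

definition lex_list :: "monom2 set \<Rightarrow> monom2 list" where
  "lex_list M = sorted_key_list_of_set snd M"

definition poly_of :: "monom2 \<Rightarrow> 'k::field poly2" where
  "poly_of m = Poly_Mapping.single m 1"

definition scalar :: "'k::field \<Rightarrow> 'k poly2 \<Rightarrow> 'k poly2" where
  "scalar c p = Poly_Mapping.single 0 c * p"

definition homogeneous :: "nat \<Rightarrow> 'k::field poly2 set" where
  "homogeneous i = {p. Poly_Mapping.keys p \<subseteq> monoms i}"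

text \<open>Ideals are the submodules of the ring regarded as a module over itself.\<close>

definition ideal_gen :: "'k::field poly2 set \<Rightarrow> 'k poly2 set" where
  "ideal_gen S = module.span (*) S"

definition ideal_sum :: "'k::field poly2 set \<Rightarrow> 'k poly2 set \<Rightarrow> 'k poly2 set" where
  "ideal_sum I J = {p + q | p q. p \<in> I \<and> q \<in> J}"

primrec ideal_power :: "'k::field poly2 set \<Rightarrow> nat \<Rightarrow> 'k poly2 set" where
  "ideal_power I 0 = UNIV"
| "ideal_power I (Suc n) = ideal_gen {p * q | p q. p \<in> I \<and> q \<in> ideal_power I n}"

definition max_ideal :: "'k::field poly2 set" where
  "max_ideal = ideal_gen {poly_of (1, 0), poly_of (0, 1)}"

text \<open>
  The Hilbert function of \<open>R/I\<close> for a homogeneous ideal \<open>I\<close>. As \<open>(R/I)\<^sub>i = R\<^sub>i / I\<^sub>i\<close> with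
  \<open>I\<^sub>i = I \<inter> R\<^sub>i\<close> a subspace of the finite-dimensional space \<open>R\<^sub>i\<close>, the subtraction of naturals
  is exact.
\<close>

definition hilbert_fun :: "'k::field poly2 set \<Rightarrow> nat \<Rightarrow> nat" where
  "hilbert_fun I i =
     vector_space.dim scalar (homogeneous i :: 'k poly2 set)
       - vector_space.dim scalar (I \<inter> homogeneous i)"

section \<open>Partitions\<close>

text \<open>A partition is the list of its parts; \<open>P ! b\<close> is the length of the row of \<open>y\<close>-degree \<open>b\<close>.\<close>

definition is_partition :: "nat list \<Rightarrow> bool" where
  "is_partition P \<longleftrightarrow> sorted_wrt (\<ge>) P \<and> (\<forall>p\<in>set P. 0 < p)"

definition C_set :: "nat list \<Rightarrow> monom2 set" where
  "C_set P = {(a, b). b < length P \<and> a < P ! b}"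

definition E_set :: "nat list \<Rightarrow> monom2 set" where
  "E_set P = - C_set P"

definition E_ideal :: "nat list \<Rightarrow> 'k::field poly2 set" where
  "E_ideal P = ideal_gen (poly_of ` E_set P)"

text \<open>
  The argument of type \<open>'k itself\<close> only records the ground field.
\<close>

definition diag_lengths :: "'k::field itself \<Rightarrow> nat list \<Rightarrow> nat \<Rightarrow> nat" where
  "diag_lengths k P = hilbert_fun (E_ideal P :: 'k poly2 set)"

text \<open>
  The sequence \<open>(1, 2, \<dots>, d, t\<^sub>d, \<dots>, t\<^sub>j, 0, 0, \<dots>)\<close>, indexed from \<open>0\<close>; the conventions
  \<open>t\<^sub>d\<^sub>-\<^sub>1 = d\<close> and \<open>t\<^sub>j\<^sub>+\<^sub>1 = 0\<close> are built in.
\<close>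

definition T_seq :: "nat \<Rightarrow> nat \<Rightarrow> (nat \<Rightarrow> nat) \<Rightarrow> nat \<Rightarrow> nat" where
  "T_seq d j t = (\<lambda>n. if n < d then n + 1 else if n \<le> j then t n else 0)"

text \<open>
  \<open>\<delta>\<^sub>i = t\<^sub>i\<^sub>-\<^sub>1 - t\<^sub>i\<close>, where \<open>t\<close> is the diagonal lengths of \<open>P\<close>; it is used for
  \<open>d \<le> i \<le> j + 1\<close> only, where \<open>1 \<le> i\<close> and \<open>t\<^sub>i \<le> t\<^sub>i\<^sub>-\<^sub>1\<close>.
\<close>

definition delta :: "'k::field itself \<Rightarrow> nat list \<Rightarrow> nat \<Rightarrow> nat" where
  "delta k P i = diag_lengths k P (i - 1) - diag_lengths k P i"

section \<open>The difference-one hook code\<close>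

text \<open>The hook with corner \<open>(a, b)\<close>, arm of length \<open>u\<close> and leg of length \<open>v\<close>.\<close>

definition is_hook :: "nat list \<Rightarrow> monom2 \<times> nat \<times> nat \<Rightarrow> bool" where
  "is_hook P = (\<lambda>((a, b), u, v).
     1 \<le> u \<and> 1 \<le> v \<and>
     (\<forall>r<u. (a + r, b) \<in> C_set P) \<and> (a + u, b) \<in> E_set P \<and>
     (\<forall>r<v. (a, b + r) \<in> C_set P) \<and> (a, b + v) \<in> E_set P)"

definition hand :: "monom2 \<times> nat \<times> nat \<Rightarrow> monom2" where
  "hand = (\<lambda>((a, b), u, v). (a + u - 1, b))"

definition difference_one :: "monom2 \<times> nat \<times> nat \<Rightarrow> bool" where
  "difference_one = (\<lambda>(c, u, v). int u - int v = 1)"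

definition hook_count :: "nat list \<Rightarrow> monom2 \<Rightarrow> nat" where
  "hook_count P \<nu> = card {h. is_hook P h \<and> difference_one h \<and> hand h = \<nu>}"

definition hand_monoms :: "nat list \<Rightarrow> nat \<Rightarrow> monom2 set" where
  "hand_monoms P i = {(a, b) \<in> monoms i. (a, b) \<in> C_set P \<and> (a + 1, b) \<in> E_set P}"

definition first_hands :: "'k::field itself \<Rightarrow> nat list \<Rightarrow> nat \<Rightarrow> monom2 list" where
  "first_hands k P i = take (delta k P (i + 1)) (lex_list (hand_monoms P i))"

definition hook_block :: "'k::field itself \<Rightarrow> nat list \<Rightarrow> nat \<Rightarrow> nat list" where
  "hook_block k P i = map (hook_count P) (first_hands k P i)"

text \<open>
  The hook code with its blocks in hand-degrees \<open>d, \<dots>, j\<close>. For diagonal lengths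
  \<open>(1, 2, \<dots>, d', t', 0)\<close> there is, by convention, the single block in hand-degree \<open>d'\<close>, that is,
  \<open>d = j = d'\<close>, also when \<open>t' = 0\<close>.
\<close>

definition hook_code :: "'k::field itself \<Rightarrow> nat \<Rightarrow> nat \<Rightarrow> nat list \<Rightarrow> nat list list" where
  "hook_code k d j P = map (hook_block k P) [d..<j + 1]"

section \<open>The component partitions\<close>

definition horizontal_border :: "nat list \<Rightarrow> nat \<Rightarrow> monom2 set" where
  "horizontal_border P i =
     {(a, b) \<in> monoms i. (a, b) \<in> E_set P \<and> 0 < b \<and> (a, b - 1) \<notin> E_set P}"

definition vertical_border :: "nat list \<Rightarrow> nat \<Rightarrow> monom2 set" where
  "vertical_border P i =
     {(a, b) \<in> monoms i. (a, b) \<in> E_set P \<and> 0 < a \<and> (a - 1, b) \<notin> E_set P}"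

definition upper_vertical_border :: "nat list \<Rightarrow> nat \<Rightarrow> monom2 set" where
  "upper_vertical_border P i =
     {m \<in> vertical_border P i. \<forall>n \<in> horizontal_border P i. lex_less m n}"

definition V1 :: "nat list \<Rightarrow> nat \<Rightarrow> monom2 set" where
  "V1 P i =
     (if (i, 0) \<in> C_set P then horizontal_border P i
      else insert (last (lex_list (upper_vertical_border P i))) (horizontal_border P i))"

definition V2 :: "'k::field itself \<Rightarrow> nat list \<Rightarrow> nat \<Rightarrow> monom2 set" where
  "V2 k P i = set (first_hands k P i)"

definition comp_degree :: "'k::field itself \<Rightarrow> nat list \<Rightarrow> nat \<Rightarrow> nat" where
  "comp_degree k P i = delta k P i + delta k P (i + 1)"

text \<open>
  The order-preserving bijection \<open>s\<^sub>i\<close>; the condition \<open>s \<in> extensional _\<close> fixes the values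
  outside its domain, which makes it unique as a total function.
\<close>

definition comp_bij :: "'k::field itself \<Rightarrow> nat list \<Rightarrow> nat \<Rightarrow> monom2 \<Rightarrow> monom2" where
  "comp_bij k P i =
     (THE s. s \<in> extensional (V1 P i \<union> V2 k P i) \<and>
        bij_betw s (V1 P i \<union> V2 k P i) (monoms (comp_degree k P i)) \<and>
        monotone_on (V1 P i \<union> V2 k P i) lex_less lex_less s)"

definition component :: "'k::field itself \<Rightarrow> nat list \<Rightarrow> nat \<Rightarrow> nat list" where
  "component k P i =
     (THE Q. is_partition Q \<and>
        (E_ideal Q :: 'k poly2 set) =
          ideal_sum (ideal_gen (poly_of ` comp_bij k P i ` V1 P i))
            (ideal_power max_ideal (comp_degree k P i + 1)))"

section \<open>The Hilbert function counts the cells on a diagonal\<close>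

lemma module_poly2: "module ((*) :: 'k::field poly2 \<Rightarrow> _)"
  by unfold_locales (auto simp: algebra_simps)

lemma lookup_scalar: "Poly_Mapping.lookup (scalar c p) m = c * Poly_Mapping.lookup p (m::monom2)"
  unfolding scalar_def
  by (simp add: mult_map_scale_conv_mult[symmetric] Poly_Mapping.map.rep_eq when_def)


lemma vector_space_poly2: "vector_space (scalar :: 'k::field \<Rightarrow> _)"
  by unfold_locales (auto intro!: poly_mapping_eqI simp: lookup_scalar lookup_add algebra_simps)

lemma scalar_monom: "scalar c (poly_of m) = Poly_Mapping.single m c"
  by (auto intro!: poly_mapping_eqI simp: lookup_scalar lookup_single poly_of_def when_def)

lemma poly2_expand: "p = (\<Sum>m\<in>Poly_Mapping.keys p. Poly_Mapping.single m (Poly_Mapping.lookup p m))"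
proof (rule poly_mapping_eqI)
  fix n
  have "(\<Sum>m\<in>Poly_Mapping.keys p. Poly_Mapping.lookup (Poly_Mapping.single m (Poly_Mapping.lookup p m)) n)
     = (\<Sum>m\<in>Poly_Mapping.keys p. if m = n then Poly_Mapping.lookup p n else 0)"
    by (intro sum.cong) (auto simp: lookup_single when_def)
  also have "\<dots> = Poly_Mapping.lookup p n"
    by (simp add: sum.delta in_keys_iff)
  finally show "Poly_Mapping.lookup p n = Poly_Mapping.lookup (\<Sum>m\<in>Poly_Mapping.keys p. Poly_Mapping.single m (Poly_Mapping.lookup p m)) n"
    by (simp add: lookup_sum)
qed

lemma ideal_gen_monomials:
  assumes up: "\<And>m n. m \<in> M \<Longrightarrow> m + n \<in> M"
  shows "ideal_gen (poly_of ` M) = {p :: 'k::field poly2. Poly_Mapping.keys p \<subseteq> M}"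
proof -
  interpret module "(*) :: 'k poly2 \<Rightarrow> _" by (rule module_poly2)
  have "span (poly_of ` M) \<subseteq> {p :: 'k::field poly2. Poly_Mapping.keys p \<subseteq> M}"
  proof (rule span_minimal)
    show "poly_of ` M \<subseteq> {p :: 'k::field poly2. Poly_Mapping.keys p \<subseteq> M}"
      by (auto simp: poly_of_def)
    show "subspace {p :: 'k::field poly2. Poly_Mapping.keys p \<subseteq> M}"
      unfolding subspace_def
    proof (safe, goal_cases)
      case (2 x y a b) then show ?case using keys_add[of x y] by blast
    next
      case (3 c x a b) then show ?case using keys_mult[of c x] up
        by (smt (verit) add.commute mem_Collect_eq subset_iff)
    qed auto
  qed
  moreover have "p \<in> span (poly_of ` M)" if "Poly_Mapping.keys p \<subseteq> M" for p :: "'k poly2"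
  proof -
    have "Poly_Mapping.single m c = Poly_Mapping.single 0 c * poly_of m" for m and c :: 'k
      by (simp add: scalar_def[symmetric] scalar_monom)
    then have "(\<Sum>m\<in>Poly_Mapping.keys p. Poly_Mapping.single m (Poly_Mapping.lookup p m)) \<in> span (poly_of ` M)"
      using that by (intro span_sum) (metis span_scale span_base imageI subsetD)
    then show ?thesis using poly2_expand[of p] by simp
  qed
  ultimately show ?thesis unfolding ideal_gen_def by blast
qed

lemma E_set_add_closed: assumes "is_partition P" "m \<in> E_set P" shows "m + n \<in> E_set P"
proof (rule ccontr)
  assume a: "m + n \<notin> E_set P"
  obtain a b c e where mn: "m = (a,b)" "n = (c,e)" by (metis surj_pair)
  from a have h: "b + e < length P" "a + c < P ! (b+e)" by (auto simp: mn E_set_def C_set_def)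
  have "P ! (b + e) \<le> P ! b" using assms(1) h by (cases "e = 0") (auto simp: is_partition_def sorted_wrt_iff_nth_less)
  with h assms(2) show False by (auto simp: mn E_set_def C_set_def)
qed

lemma dim_keys_subset:
  assumes "finite A"
  shows "vector_space.dim scalar {p :: 'k::field poly2. Poly_Mapping.keys p \<subseteq> A} = card A"
proof -
  interpret vector_space "scalar :: 'k \<Rightarrow> _" by (rule vector_space_poly2)
  have inj: "inj_on (poly_of :: _ \<Rightarrow> 'k poly2) A"
    by (auto simp: inj_on_def poly_of_def dest: arg_cong[where f = Poly_Mapping.keys])
  have ind: "independent (poly_of ` A :: 'k poly2 set)"
  proof (rule independent_if_scalars_zero)
    show "finite (poly_of ` A :: 'k poly2 set)" using assms by simp
    fix f :: "'k poly2 \<Rightarrow> 'k" and x :: "'k poly2" assume s: "(\<Sum>x\<in>poly_of ` A. scalar (f x) x) = 0" and x: "x \<in> poly_of ` A"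
    then obtain n where n: "n \<in> A" "x = poly_of n" by auto
    have "0 = (\<Sum>m\<in>A. Poly_Mapping.single m (f (poly_of m)))"
      using s by (simp add: sum.reindex[OF inj] scalar_monom)
    then have "0 = Poly_Mapping.lookup (\<Sum>m\<in>A. Poly_Mapping.single m (f (poly_of m))) n" by (metis lookup_zero)
    also have "\<dots> = (\<Sum>m\<in>A. if m = n then f (poly_of n) else 0)"
      unfolding lookup_sum by (intro sum.cong) (auto simp: lookup_single when_def)
    finally show "f x = 0" using assms n by simp
  qed
  have sp: "{p :: 'k::field poly2. Poly_Mapping.keys p \<subseteq> A} \<subseteq> span (poly_of ` A)"
  proof safe
    fix p :: "'k poly2" assume p: "Poly_Mapping.keys p \<subseteq> A"
    have "(\<Sum>m\<in>Poly_Mapping.keys p. scalar (Poly_Mapping.lookup p m) (poly_of m)) \<in> span (poly_of ` A)"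
      using p by (intro span_sum span_scale span_base) auto
    then show "p \<in> span (poly_of ` A)" using poly2_expand[of p] by (simp add: scalar_monom)
  qed
  show ?thesis
    by (rule dim_unique[OF _ sp ind]) (auto simp: poly_of_def card_image[OF inj, unfolded poly_of_def])
qed

theorem diag_lengths_eq_card: assumes "is_partition P"
  shows "diag_lengths (k :: 'k::field itself) P i = card (C_set P \<inter> monoms i)"
proof -
  have "monoms i \<subseteq> {..i} \<times> {..i}" by (auto simp: monoms_def deg_def)
  then have fin: "finite (monoms i)" using finite_subset by blast
  have e: "(E_ideal P :: 'k poly2 set) \<inter> homogeneous i = {p. Poly_Mapping.keys p \<subseteq> E_set P \<inter> monoms i}"
    unfolding E_ideal_def using ideal_gen_monomials[where M = "E_set P"] E_set_add_closed[OF assms] by (auto simp: homogeneous_def)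
  have "diag_lengths k P i = card (monoms i) - card (E_set P \<inter> monoms i)"
    unfolding diag_lengths_def hilbert_fun_def e
    unfolding homogeneous_def
    by (simp only: dim_keys_subset[OF fin] dim_keys_subset[OF finite_Int[OF disjI2[OF fin]]])
  also have "\<dots> = card (monoms i - E_set P)" using fin by (simp add: card_Diff_subset_Int Int_commute)
  also have "monoms i - E_set P = C_set P \<inter> monoms i" by (auto simp: E_set_def)
  finally show ?thesis .
qed

end

theory Submission
  imports Defs
begin

text \<open>
  The hook code of \<open>P\<close> in hand-degree \<open>i\<close> depends only on how the degree-\<open>i\<close> hands and the
  degree-\<open>i\<close> horizontal-border monomials are interleaved along the diagonal. A hook with hand
  \<open>\<nu>\<close> and foot \<open>\<mu>\<close> has arm one longer than its leg exactly when \<open>y \<mu>\<close> has the same degree as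
  \<open>\<nu>\<close>, and \<open>y \<mu>\<close> is then a horizontal-border monomial below \<open>\<nu>\<close>. As conversely each such
  border monomial determines a corner in the row of \<open>\<nu>\<close> and the column of \<open>\<mu>\<close>, the number of
  difference-one hooks with hand \<open>\<nu>\<close> is the number of horizontal-border monomials of degree
  \<open>deg \<nu>\<close> below \<open>\<nu>\<close> (\<open>hook_count_eq_card_border_below\<close>).

  The set \<open>V\<^sub>i\<^sub>1\<close> consists of the horizontal border and possibly one vertical-border monomial. That
  extra monomial lies above every hand: below a hand the diagonal can leave the Ferrers diagram
  only through the horizontal border, but all of that border is below the extra monomial. So the
  hook count of a hand \<open>\<nu>\<close> is also the number of elements of \<open>V\<^sub>i\<^sub>1\<close> below \<open>\<nu>\<close>
  (\<open>hook_count_eq_card_V1_below\<close>), a number that the order-preserving bijection \<open>s\<^sub>i\<close> keeps.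

  The diagram of the component consists of all monomials of degree less than \<open>d\<^sub>i\<close> and, in degree
  \<open>d\<^sub>i\<close>, of \<open>s\<^sub>i(V\<^sub>i\<^sub>2)\<close>. All of the latter are hands, and the horizontal border in degree \<open>d\<^sub>i\<close>
  is \<open>s\<^sub>i(V\<^sub>i\<^sub>1)\<close> without the topmost monomial of the diagonal, which is below nothing. Hence the hook count of
  \<open>s\<^sub>i(\<nu>)\<close> is the number of elements of \<open>s\<^sub>i(V\<^sub>i\<^sub>1)\<close> below it (\<open>hook_block_top_degree\<close>), the
  same number as for \<open>\<nu>\<close> in \<open>P\<close>.

  That \<open>s\<^sub>i\<close> and the component exist and are unique needs the cardinalities of \<open>V\<^sub>i\<^sub>1\<close> and
  \<open>V\<^sub>i\<^sub>2\<close>, which come from multiplying the cells of one diagonal by \<open>y\<close> and by \<open>x\<close>, and the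
  correspondence between partitions and monomial ideals.
\<close>

section \<open>Monomials of a fixed degree\<close>

lemma finite_monoms: "finite (monoms i)"
proof -
  have "monoms i \<subseteq> {..i} \<times> {..i}" by (auto simp: monoms_def deg_def)
  then show ?thesis using finite_subset by blast
qed

lemma finite_subset_monoms: "M \<subseteq> monoms i \<Longrightarrow> finite M"
  using finite_monoms finite_subset by blast

lemma card_monoms: "card (monoms i) = i + 1"
proof -
  have "monoms i = (\<lambda>b. (i - b, b)) ` {..i}" by (force simp: monoms_def deg_def image_iff)
  then show ?thesis by (simp add: card_image inj_on_def)
qed

lemma monoms_eqI: "m \<in> monoms i \<Longrightarrow> n \<in> monoms i \<Longrightarrow> snd m = snd n \<Longrightarrow> m = n"
  by (auto simp: monoms_def deg_def prod_eq_iff)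

lemma inj_on_snd_monoms: "inj_on snd (monoms i)"
  by (intro inj_onI) (rule monoms_eqI)

lemma (in linorder) sorted_key_list_of_set_inj_on:
  assumes "inj_on f A" "finite A"
  shows "set (sorted_key_list_of_set f A) = A" "sorted_wrt (<) (map f (sorted_key_list_of_set f A))"
proof -
  interpret folding_insort_key "(\<le>)" "(<)" A f
    by unfold_locales (rule assms)
  show "set (sorted_key_list_of_set f A) = A" "sorted_wrt (<) (map f (sorted_key_list_of_set f A))"
    using assms by simp_all
qed

lemma lex_list_sorted:
  assumes "M \<subseteq> monoms i"
  shows set_lex_list: "set (lex_list M) = M" and sorted_lex_list: "sorted_wrt lex_less (lex_list M)"
  using sorted_key_list_of_set_inj_on[OF inj_on_subset[OF inj_on_snd_monoms assms] finite_subset_monoms[OF assms]]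
  by (simp_all add: lex_list_def lex_less_def[abs_def] sorted_wrt_map)

text \<open>
  On monomials of one degree the \<open>y\<close>-degree is injective, so a lexicographically increasing list is
  determined by its set of entries.
\<close>

lemma lex_sorted_unique:
  assumes "sorted_wrt lex_less xs" "sorted_wrt lex_less ys" "set xs = set ys" "set xs \<subseteq> monoms i"
  shows "xs = ys"
proof -
  have "sorted_wrt (<) (map snd xs)" "sorted_wrt (<) (map snd ys)"
    using assms(1,2) by (simp_all add: sorted_wrt_map lex_less_def[abs_def])
  then have "map snd xs = map snd ys"
    using assms(3) by (intro strict_sorted_equal) auto
  then show ?thesis
    using assms(3,4) by (intro map_inj_on[of snd xs ys]) (auto intro: inj_on_subset[OF inj_on_snd_monoms])
qed

lemma length_lex_list: "M \<subseteq> monoms i \<Longrightarrow> length (lex_list M) = card M"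
proof -
  assume M: "M \<subseteq> monoms i"
  have "sorted_wrt (<) (map snd (lex_list M))"
    using sorted_lex_list[OF M] by (simp add: sorted_wrt_map lex_less_def[abs_def])
  then have "distinct (lex_list M)" by (simp add: strict_sorted_iff distinct_map)
  then show ?thesis using distinct_card set_lex_list[OF M] by metis
qed

lemma lex_list_map:
  assumes "M \<subseteq> monoms i" "s ` M \<subseteq> monoms n" "monotone_on M lex_less lex_less s"
  shows "lex_list (s ` M) = map s (lex_list M)"
proof (rule lex_sorted_unique)
  show "sorted_wrt lex_less (map s (lex_list M))"
    unfolding sorted_wrt_map
    by (rule sorted_wrt_mono_rel[OF _ sorted_lex_list[OF assms(1)]])
       (use assms(3) set_lex_list[OF assms(1)] in \<open>auto simp: monotone_on_def\<close>)
qed (use assms in \<open>auto simp: set_lex_list sorted_lex_list\<close>)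

text \<open>
  Both maps carry the increasing list of \<open>M\<close> to the increasing list of the whole degree-\<open>n\<close>
  diagonal.
\<close>

lemma order_bij_unique:
  assumes M: "M \<subseteq> monoms i"
    and s: "bij_betw s M (monoms n)" "monotone_on M lex_less lex_less s"
    and s': "bij_betw s' M (monoms n)" "monotone_on M lex_less lex_less s'"
    and m: "m \<in> M"
  shows "s m = s' m"
proof -
  have "map s (lex_list M) = map s' (lex_list M)"
    using lex_list_map[OF M, of s n] lex_list_map[OF M, of s' n] s s'
    by (simp add: bij_betw_imp_surj_on)
  then show ?thesis using m by (simp add: set_lex_list[OF M])
qed

text \<open>
  The bijection sends the element with \<open>r\<close> predecessors in \<open>M\<close> to \<open>x^(n - r) y^r\<close>.
\<close>

lemma order_bij_ex1:
  assumes M: "M \<subseteq> monoms i" and card: "card M = n + 1"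
  shows "\<exists>!s. s \<in> extensional M \<and> bij_betw s M (monoms n) \<and> monotone_on M lex_less lex_less s"
proof -
  define r where "r m = card {l \<in> M. lex_less l m}" for m
  define s where "s m = (n - r m, r m)" for m
  note fin = finite_subset_monoms[OF M]
  have "r m \<le> n" if "m \<in> M" for m
  proof -
    have "r m < card M"
      unfolding r_def using that fin by (intro psubset_card_mono) (auto simp: lex_less_def)
    then show ?thesis using card by simp
  qed
  then have into: "s ` M \<subseteq> monoms n" by (auto simp: s_def monoms_def deg_def)
  have less: "r l < r m" if "l \<in> M" "m \<in> M" "lex_less l m" for l m
    unfolding r_def using that fin by (intro psubset_card_mono) (auto simp: lex_less_def)
  then have mono: "monotone_on M lex_less lex_less s"
    by (auto simp: monotone_on_def s_def lex_less_def)
  have inj: "inj_on s M"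
  proof (rule inj_onI)
    fix l m assume lm: "l \<in> M" "m \<in> M" "s l = s m"
    then have "\<not> snd l < snd m" "\<not> snd m < snd l"
      using less[of l m] less[of m l] by (auto simp: s_def lex_less_def)
    then show "l = m" using lm M by (intro monoms_eqI[of l i m]) auto
  qed
  have "s ` M = monoms n"
    using into inj card by (intro card_subset_eq finite_monoms) (simp_all add: card_image card_monoms)
  then have bij: "bij_betw s M (monoms n)" using inj by (simp add: bij_betw_def)
  show ?thesis
  proof (rule ex1I[of _ "restrict s M"])
    show "restrict s M \<in> extensional M \<and> bij_betw (restrict s M) M (monoms n)
        \<and> monotone_on M lex_less lex_less (restrict s M)"
      using bij mono by (auto simp: monotone_on_def)
  next
    fix s' assume s': "s' \<in> extensional M \<and> bij_betw s' M (monoms n) \<and> monotone_on M lex_less lex_less s'"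
    show "s' = restrict s M"
      by (rule extensionalityI[of _ M]) (use s' order_bij_unique[OF M _ _ bij mono] in auto)
  qed
qed

lemma lex_less_mono_iff:
  assumes "M \<subseteq> monoms i" "monotone_on M lex_less lex_less s" "l \<in> M" "m \<in> M"
  shows "lex_less (s l) (s m) \<longleftrightarrow> lex_less l m"
proof -
  have "l = m \<or> lex_less l m \<or> lex_less m l"
    using assms monoms_eqI[of l i m] unfolding lex_less_def by (meson linorder_cases subsetD)
  then show ?thesis using assms(2-4) by (auto simp: monotone_on_def lex_less_def dest: order_less_asym)
qed

section \<open>Cells, hands and borders\<close>

lemma C_set_down:
  assumes "is_partition P" "(a, b) \<in> C_set P" "a' \<le> a" "b' \<le> b"
  shows "(a', b') \<in> C_set P"
  using assms E_set_add_closed[of P "(a', b')" "(a - a', b - b')"] by (auto simp: E_set_def)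

lemma horizontal_border_subset: "horizontal_border P i \<subseteq> monoms i"
  by (auto simp: horizontal_border_def)

lemma hand_monoms_subset: "hand_monoms P i \<subseteq> monoms i"
  by (auto simp: hand_monoms_def)

text \<open>
  The bijection sends a hook with foot \<open>\<mu>\<close> to \<open>y \<mu>\<close>: for a corner \<open>(a, b)\<close>, arm length \<open>u\<close> and
  leg length \<open>v\<close>, the hand has degree \<open>a + b + u - 1\<close> and \<open>y \<mu>\<close> has degree \<open>a + b + v\<close>, and
  these agree if and only if \<open>u - v = 1\<close>.
\<close>

lemma hook_count_eq_card_border_below:
  assumes P: "is_partition P" and nu: "\<nu> \<in> hand_monoms P i"
  shows "hook_count P \<nu> = card {m \<in> horizontal_border P i. lex_less \<nu> m}"
proof -
  obtain \<alpha> \<beta> where ab: "\<nu> = (\<alpha>, \<beta>)" by (cases \<nu>)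
  have C: "(\<alpha>, \<beta>) \<in> C_set P" and E: "(\<alpha> + 1, \<beta>) \<in> E_set P" and i: "\<alpha> + \<beta> = i"
    using nu by (auto simp: ab hand_monoms_def monoms_def deg_def)
  define g where "g = (\<lambda>(a, c). ((a, \<beta>), \<alpha> - a + 1, c - \<beta>) :: monom2 \<times> nat \<times> nat)"
  let ?H = "{h. is_hook P h \<and> difference_one h \<and> hand h = \<nu>}"
  let ?A = "{m \<in> horizontal_border P i. lex_less \<nu> m}"
  have gH: "g (a, c) \<in> ?H" if m: "(a, c) \<in> ?A" for a c
  proof -
    from m have h: "a + c = i" "(a, c) \<in> E_set P" "(a, c - 1) \<in> C_set P" "\<beta> < c"
      by (auto simp: horizontal_border_def monoms_def deg_def lex_less_def ab E_set_def)
    then have lt: "a < \<alpha>" using i by simp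
    have "is_hook P (g (a, c))"
      using h lt E C_set_down[OF P C] C_set_down[OF P h(3)]
      by (auto simp: is_hook_def g_def)
    moreover have "difference_one (g (a, c))" "hand (g (a, c)) = \<nu>"
      using h lt i by (auto simp: difference_one_def hand_def g_def ab)
    ultimately show ?thesis by simp
  qed
  have fA: "(a, b + v) \<in> ?A" if h: "((a, b), u, v) \<in> ?H" for a b u v
  proof -
    from h have "b = \<beta>" "a + v = \<alpha>" "1 \<le> v"
      by (auto simp: is_hook_def difference_one_def hand_def ab)
    moreover have "\<forall>r<v. (a, b + r) \<in> C_set P" using h by (simp add: is_hook_def)
    from this[rule_format, of "v - 1"] have "(a, b + v - 1) \<in> C_set P" using \<open>1 \<le> v\<close> by simp
    ultimately show ?thesis
      using h i by (auto simp: is_hook_def horizontal_border_def monoms_def deg_def lex_less_def ab E_set_def)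
  qed
  have "bij_betw g ?A ?H"
  proof (rule bij_betw_byWitness[where f' = "\<lambda>((a, b), u, v). (a, b + v)"])
    show "g ` ?A \<subseteq> ?H"
    proof (rule image_subsetI)
      fix m assume "m \<in> ?A"
      then show "g m \<in> ?H" using gH[of "fst m" "snd m"] by simp
    qed
    show "(\<lambda>((a, b), u, v). (a, b + v)) ` ?H \<subseteq> ?A"
    proof (rule image_subsetI)
      fix h assume "h \<in> ?H"
      then show "(\<lambda>((a, b), u, v). (a, b + v)) h \<in> ?A"
        using fA[of "fst (fst h)" "snd (fst h)" "fst (snd h)" "snd (snd h)"] by (simp add: case_prod_beta)
    qed
  qed (auto simp: g_def horizontal_border_def monoms_def deg_def lex_less_def ab is_hook_def difference_one_def hand_def)
  then show ?thesis
    unfolding hook_count_def by (simp add: bij_betw_same_card)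
qed

text \<open>
  Multiplication by \<open>y\<close> sends the cells of degree \<open>i - 1\<close> bijectively to the horizontal border and
  the cells of degree \<open>i\<close> together; only the cell \<open>x^i\<close>, when present, is not reached.
\<close>

lemma card_horizontal_border:
  assumes P: "is_partition P" and i: "1 \<le> i"
  shows "card (C_set P \<inter> monoms (i - 1)) + of_bool ((i, 0) \<in> C_set P)
    = card (horizontal_border P i) + card (C_set P \<inter> monoms i)"
proof -
  let ?Y = "(\<lambda>(a, b). (a, b + 1)) ` (C_set P \<inter> monoms (i - 1)) :: monom2 set"
  let ?Z = "{m. m = (i, 0) \<and> m \<in> C_set P}"
  have "?Y \<union> ?Z = horizontal_border P i \<union> (C_set P \<inter> monoms i)"
  proof (intro equalityI subsetI)
    fix m assume "m \<in> ?Y \<union> ?Z"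
    then show "m \<in> horizontal_border P i \<union> (C_set P \<inter> monoms i)"
      using i by (auto simp: horizontal_border_def E_set_def monoms_def deg_def)
  next
    fix m assume m: "m \<in> horizontal_border P i \<union> (C_set P \<inter> monoms i)"
    obtain a b where ab: "m = (a, b)" by (cases m)
    show "m \<in> ?Y \<union> ?Z"
    proof (cases "b = 0")
      case False
      then have "(a, b - 1) \<in> C_set P \<inter> monoms (i - 1)"
        using m C_set_down[OF P, of a b a "b - 1"]
        by (auto simp: ab horizontal_border_def E_set_def monoms_def deg_def)
      moreover have "m = (\<lambda>(a, b). (a, b + 1)) (a, b - 1)" using False ab by simp
      ultimately show ?thesis by blast
    qed (use m ab in \<open>auto simp: horizontal_border_def monoms_def deg_def\<close>)
  qed
  moreover have "card (?Y \<union> ?Z) = card (C_set P \<inter> monoms (i - 1)) + of_bool ((i, 0) \<in> C_set P)"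
  proof -
    have "card (?Y \<union> ?Z) = card ?Y + card ?Z"
      by (intro card_Un_disjoint) (auto simp: finite_monoms)
    moreover have "card ?Y = card (C_set P \<inter> monoms (i - 1))"
      by (intro card_image) (auto simp: inj_on_def)
    moreover have "?Z = (if (i, 0) \<in> C_set P then {(i, 0)} else {})" by auto
    ultimately show ?thesis by simp
  qed
  moreover have "card (horizontal_border P i \<union> (C_set P \<inter> monoms i))
      = card (horizontal_border P i) + card (C_set P \<inter> monoms i)"
    by (intro card_Un_disjoint finite_subset_monoms[OF horizontal_border_subset])
       (auto simp: finite_monoms E_set_def horizontal_border_def)
  ultimately show ?thesis by simp
qed

text \<open>
  A cell of degree \<open>i\<close> that is not a hand becomes a cell of degree \<open>i + 1\<close> when multiplied by
  \<open>x\<close>. Equality fails when \<open>y^(i + 1)\<close> is a cell; then there is one hand too many, which the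
  definition of \<open>V\<^sub>i\<^sub>2\<close> drops.
\<close>

lemma card_hand_monoms_ge:
  "card (C_set P \<inter> monoms i) \<le> card (hand_monoms P i) + card (C_set P \<inter> monoms (i + 1))"
proof -
  let ?f = "\<lambda>(a, b). (a + 1, b) :: monom2"
  have sub: "C_set P \<inter> monoms i \<subseteq> hand_monoms P i \<union> ?f -` (C_set P \<inter> monoms (i + 1))"
    by (auto simp: hand_monoms_def E_set_def monoms_def deg_def)
  have inj: "inj ?f" by (auto simp: inj_on_def)
  have "card (C_set P \<inter> monoms i) \<le> card (hand_monoms P i \<union> ?f -` (C_set P \<inter> monoms (i + 1)))"
    by (intro card_mono sub finite_UnI finite_vimageI inj)
       (auto simp: finite_monoms intro: finite_subset_monoms[OF hand_monoms_subset])
  also have "\<dots> \<le> card (hand_monoms P i) + card (?f -` (C_set P \<inter> monoms (i + 1)))"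
    by (rule card_Un_le)
  also have "card (?f -` (C_set P \<inter> monoms (i + 1))) \<le> card (C_set P \<inter> monoms (i + 1))"
    using card_vimage_inj_on_le[OF inj, of "C_set P \<inter> monoms (i + 1)"] by (simp add: finite_monoms)
  finally show ?thesis by simp
qed

text \<open>
  If \<open>\<kappa>\<close> is the topmost cell of degree \<open>i - 1\<close>, then \<open>x \<kappa>\<close> is the required monomial. It is not
  a cell: as \<open>x^i\<close> is none, it would be divisible by \<open>y\<close>, and \<open>x \<kappa> / y\<close> would be a cell of degree
  \<open>i - 1\<close> above \<open>\<kappa>\<close>. It is above the horizontal border, whose monomials are \<open>y\<close> times a cell of
  degree \<open>i - 1\<close>.
\<close>

lemma upper_vertical_border_nonempty:
  assumes P: "is_partition P" and E: "(i, 0) \<notin> C_set P" and ne: "C_set P \<inter> monoms (i - 1) \<noteq> {}" and i: "1 \<le> i"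
  shows "upper_vertical_border P i \<noteq> {}"
proof -
  define Q where "Q b \<longleftrightarrow> b \<le> i - 1 \<and> (i - 1 - b, b) \<in> C_set P" for b
  obtain a b where "(a, b) \<in> C_set P" "a + b = i - 1" using ne by (auto simp: monoms_def deg_def)
  moreover from this have "i - 1 - b = a" by simp
  ultimately have "Q b" by (simp add: Q_def)
  then obtain b where b: "Q b" and least: "\<And>c. Q c \<Longrightarrow> b \<le> c"
    by (metis LeastI Least_le)
  have "(i - b, b) \<in> E_set P"
  proof (rule ccontr)
    assume "(i - b, b) \<notin> E_set P"
    then have c: "(i - b, b) \<in> C_set P" by (simp add: E_set_def)
    then have "0 < b" using E by (cases b) auto
    then have "Q (b - 1)" using b C_set_down[OF P c, of "i - b" "b - 1"] by (auto simp: Q_def)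
    then show False using least[of "b - 1"] \<open>0 < b\<close> by simp
  qed
  then have "(i - b, b) \<in> vertical_border P i"
    using b i by (auto simp: vertical_border_def Q_def monoms_def deg_def E_set_def)
  moreover have "lex_less (i - b, b) n" if n: "n \<in> horizontal_border P i" for n
  proof -
    have "Q (snd n - 1)"
      using n i by (auto simp: Q_def horizontal_border_def monoms_def deg_def E_set_def)
    then show ?thesis using least n by (force simp: lex_less_def horizontal_border_def)
  qed
  ultimately show ?thesis unfolding upper_vertical_border_def by blast
qed

text \<open>
  Going down the diagonal from a hand \<open>n\<close> to a non-cell \<open>m\<close>, the first non-cell met is on the
  horizontal border. So if \<open>n\<close> were above \<open>m\<close>, some horizontal-border monomial would be above
  \<open>m\<close> or equal to it.
\<close>

lemma upper_vertical_border_above_hands: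
  assumes m: "m \<in> upper_vertical_border P i" and n: "n \<in> hand_monoms P i" and P: "is_partition P"
  shows "lex_less m n"
proof (rule ccontr)
  assume not: "\<not> lex_less m n"
  \<comment> \<open>The rows in which the diagonal, below the hand, is outside the diagram; the first one is wanted.\<close>
  define R where "R c \<longleftrightarrow> snd n < c \<and> c \<le> i \<and> (i - c, c) \<in> E_set P" for c
  have "m \<noteq> n" using m n by (auto simp: upper_vertical_border_def vertical_border_def hand_monoms_def E_set_def)
  then have "snd n < snd m"
    using not m n monoms_eqI[of m i n] 
    by (force simp: lex_less_def upper_vertical_border_def vertical_border_def hand_monoms_def)
  then have "R (snd m)"
    using m by (auto simp: R_def upper_vertical_border_def vertical_border_def monoms_def deg_def)
  then obtain c where c: "R c" "c \<le> snd m" and least: "\<And>e. R e \<Longrightarrow> c \<le> e"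
    by (metis LeastI Least_le)
  have "(i - (c - 1), c - 1) \<in> C_set P"
  proof (cases "c - 1 = snd n")
    case True
    then show ?thesis using n by (auto simp: hand_monoms_def monoms_def deg_def)
  next
    case False
    then show ?thesis using least[of "c - 1"] c by (force simp: R_def E_set_def)
  qed
  then have "(i - c, c - 1) \<in> C_set P" by (rule C_set_down[OF P]) simp_all
  then have "(i - c, c) \<in> horizontal_border P i"
    using c by (auto simp: R_def horizontal_border_def monoms_def deg_def E_set_def)
  then show False using m c by (force simp: upper_vertical_border_def lex_less_def)
qed

text \<open>
  The extra monomial in \<open>V1\<close> is given as the last entry of a list; what matters about it is only
  that it belongs to \<open>upper_vertical_border\<close>, for which that list must be nonempty.
\<close>

lemma V1_cases:
  assumes P: "is_partition P" and ne: "C_set P \<inter> monoms (i - 1) \<noteq> {}" and i: "1 \<le> i"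
  obtains (cell) "(i, 0) \<in> C_set P" "V1 P i = horizontal_border P i"
  | (border) e where "(i, 0) \<notin> C_set P" "e \<in> upper_vertical_border P i" "V1 P i = insert e (horizontal_border P i)"
proof (cases "(i, 0) \<in> C_set P")
  case False
  define U where "U = upper_vertical_border P i"
  have "U \<subseteq> monoms i" by (auto simp: U_def upper_vertical_border_def vertical_border_def)
  moreover have "U \<noteq> {}" unfolding U_def by (rule upper_vertical_border_nonempty[OF P False ne i])
  ultimately have "last (lex_list U) \<in> U" using last_in_set[of "lex_list U"] set_lex_list[of U i] by fastforce
  then show ?thesis using that(2)[of "last (lex_list U)"] False by (simp add: V1_def U_def)
qed (use that in \<open>simp add: V1_def\<close>)

lemma V1_subset:
  assumes "is_partition P" "C_set P \<inter> monoms (i - 1) \<noteq> {}" "1 \<le> i"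
  shows "V1 P i \<subseteq> monoms i \<inter> E_set P"
  using assms by (cases rule: V1_cases)
    (auto simp: horizontal_border_def upper_vertical_border_def vertical_border_def)

lemma card_V1:
  assumes "is_partition P" "C_set P \<inter> monoms (i - 1) \<noteq> {}" "1 \<le> i"
  shows "card (V1 P i) + card (C_set P \<inter> monoms i) = card (C_set P \<inter> monoms (i - 1)) + 1"
  using assms
proof (cases rule: V1_cases)
  case cell
  then show ?thesis using card_horizontal_border[OF assms(1,3)] by simp
next
  case (border e)
  have "finite (horizontal_border P i)"
    by (rule finite_subset_monoms[OF horizontal_border_subset])
  moreover have "e \<notin> horizontal_border P i"
    using border(2) by (auto simp: upper_vertical_border_def lex_less_def)
  ultimately show ?thesis
    using card_horizontal_border[OF assms(1,3)] border by simp
qed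

text \<open>
  The extra vertical-border monomial of \<open>V1\<close> is above all hands, so it is never counted.
\<close>

lemma hook_count_eq_card_V1_below:
  assumes "is_partition P" "C_set P \<inter> monoms (i - 1) \<noteq> {}" "1 \<le> i" "\<nu> \<in> hand_monoms P i"
  shows "hook_count P \<nu> = card {m \<in> V1 P i. lex_less \<nu> m}"
  using assms(1-3)
proof (cases rule: V1_cases)
  case cell
  then show ?thesis using hook_count_eq_card_border_below[OF assms(1,4)] by simp
next
  case (border e)
  have "\<not> lex_less \<nu> e"
    using upper_vertical_border_above_hands[OF border(2) assms(4,1)] by (simp add: lex_less_def)
  then have "{m \<in> V1 P i. lex_less \<nu> m} = {m \<in> horizontal_border P i. lex_less \<nu> m}"
    using border by auto
  then show ?thesis using hook_count_eq_card_border_below[OF assms(1,4)] by simp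
qed

lemma V2_subset: "V2 k P i \<subseteq> hand_monoms P i"
  unfolding V2_def first_hands_def using set_take_subset set_lex_list[OF hand_monoms_subset] by metis

lemma lex_list_V2: "lex_list (V2 k P i) = first_hands k P i"
proof (rule lex_sorted_unique)
  have "V2 k P i \<subseteq> monoms i" using V2_subset hand_monoms_subset by blast
  then show "sorted_wrt lex_less (lex_list (V2 k P i))" "set (lex_list (V2 k P i)) = set (first_hands k P i)"
    "set (lex_list (V2 k P i)) \<subseteq> monoms i"
    by (simp_all add: sorted_lex_list set_lex_list V2_def)
  show "sorted_wrt lex_less (first_hands k P i)"
    unfolding first_hands_def by (intro sorted_wrt_take sorted_lex_list[OF hand_monoms_subset])
qed

lemma card_V2:
  assumes "is_partition P"
  shows "card (V2 k P i) = delta k P (i + 1)"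
proof -
  have "V2 k P i \<subseteq> monoms i" using V2_subset hand_monoms_subset by blast
  then have "card (V2 k P i) = length (first_hands k P i)"
    using length_lex_list[of "V2 k P i" i] by (simp add: lex_list_V2)
  also have "\<dots> = min (card (hand_monoms P i)) (delta k P (i + 1))"
    by (simp add: first_hands_def length_lex_list[OF hand_monoms_subset])
  also have "\<dots> = delta k P (i + 1)"
    using card_hand_monoms_ge[of P i] by (simp add: delta_def diag_lengths_eq_card[OF assms])
  finally show ?thesis .
qed

section \<open>Monomial ideals and partitions\<close>

lemma ideal_gen_monomials_upset:
  "ideal_gen (poly_of ` M) = {p :: 'k::field poly2. Poly_Mapping.keys p \<subseteq> {m + n | m n. m \<in> M}}"
proof -
  interpret module "(*) :: 'k poly2 \<Rightarrow> _" by (rule module_poly2)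
  let ?U = "{m + n | m n. m \<in> M}"
  have "span (poly_of ` M) = (span (poly_of ` ?U) :: 'k poly2 set)"
  proof (rule span_eq[THEN iffD2], intro conjI subsetI)
    fix p :: "'k poly2" assume "p \<in> poly_of ` M"
    then obtain m where "m \<in> M" "p = poly_of (m + 0)" by auto
    then show "p \<in> span (poly_of ` ?U)" by (intro span_base) blast
  next
    fix p :: "'k poly2" assume "p \<in> poly_of ` ?U"
    then obtain m n where "m \<in> M" "p = poly_of n * poly_of m" 
      by (auto simp: poly_of_def mult_single add.commute)
    then show "p \<in> span (poly_of ` M)" by (auto intro: span_scale span_base)
  qed
  moreover have "ideal_gen (poly_of ` ?U) = {p :: 'k poly2. Poly_Mapping.keys p \<subseteq> ?U}"
    by (rule ideal_gen_monomials) (auto, metis add.assoc)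
  ultimately show ?thesis by (simp add: ideal_gen_def)
qed

lemma max_ideal_eq: "max_ideal = {p :: 'k::field poly2. Poly_Mapping.keys p \<subseteq> {m. 1 \<le> deg m}}"
proof -
  have "{m + n | m n. m \<in> {(1, 0), (0, 1)}} = {m. 1 \<le> deg m}"
  proof (intro equalityI subsetI)
    fix m :: monom2 assume "m \<in> {m. 1 \<le> deg m}"
    then have "m = (1, 0) + (fst m - 1, snd m) \<or> m = (0, 1) + (fst m, snd m - 1)"
      by (cases m) (auto simp: deg_def)
    then show "m \<in> {m + n | m n. m \<in> {(1, 0), (0, 1)}}" by blast
  qed (auto simp: deg_def)
  then show ?thesis
    unfolding max_ideal_def using ideal_gen_monomials_upset[of "{(1, 0), (0, 1)}", where 'k = 'k] by simp
qed

text \<open>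
  For the inclusion from right to left, each monomial of degree at least \<open>n + 1\<close> is \<open>x\<close> or \<open>y\<close>
  times a monomial of degree at least \<open>n\<close>.
\<close>

lemma ideal_power_max_ideal:
  "ideal_power max_ideal n = {p :: 'k::field poly2. Poly_Mapping.keys p \<subseteq> {m. n \<le> deg m}}"
proof (induction n)
  case (Suc n)
  interpret module "(*) :: 'k poly2 \<Rightarrow> _" by (rule module_poly2)
  let ?G = "{p * q | p q :: 'k poly2. p \<in> max_ideal \<and> q \<in> ideal_power max_ideal n}"
  have gen: "ideal_gen (poly_of ` {m. Suc n \<le> deg m}) = {p :: 'k poly2. Poly_Mapping.keys p \<subseteq> {m. Suc n \<le> deg m}}"
    by (rule ideal_gen_monomials) (auto simp: deg_def)
  have "?G \<subseteq> ideal_gen (poly_of ` {m. Suc n \<le> deg m})"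
  proof safe
    fix p q :: "'k poly2" assume "p \<in> max_ideal" "q \<in> ideal_power max_ideal n"
    then have "Poly_Mapping.keys p \<subseteq> {m. 1 \<le> deg m}" "Poly_Mapping.keys q \<subseteq> {m. n \<le> deg m}"
      using Suc.IH by (auto simp: max_ideal_eq)
    then show "p * q \<in> ideal_gen (poly_of ` {m. Suc n \<le> deg m})"
      unfolding gen using keys_mult[of p q] by (fastforce simp: deg_def)
  qed
  then have "ideal_gen ?G \<subseteq> ideal_gen (poly_of ` {m. Suc n \<le> deg m})"
    unfolding ideal_gen_def by (intro span_minimal subspace_span)
  moreover have "poly_of ` {m. Suc n \<le> deg m} \<subseteq> ideal_gen ?G"
  proof safe
    fix a b assume ab: "Suc n \<le> deg (a, b)"
    define m where "m = (if 0 < a then (1, 0) else (0, 1) :: monom2)"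
    define l where "l = (if 0 < a then (a - 1, b) else (a, b - 1))"
    have "deg m = 1" "n \<le> deg l" "(a, b) = m + l"
      using ab by (auto simp: m_def l_def deg_def)
    then have "poly_of m \<in> (max_ideal :: 'k poly2 set)" "poly_of l \<in> (ideal_power max_ideal n :: 'k poly2 set)"
       "(poly_of (a, b) :: 'k poly2) = poly_of m * poly_of l"
      using Suc.IH by (auto simp: max_ideal_eq poly_of_def mult_single)
    then show "(poly_of (a, b) :: 'k poly2) \<in> ideal_gen ?G"
      unfolding ideal_gen_def by (intro span_base) blast
  qed
  then have "ideal_gen (poly_of ` {m. Suc n \<le> deg m}) \<subseteq> ideal_gen ?G"
    unfolding ideal_gen_def by (intro span_minimal subspace_span)
  ultimately show ?case using gen by simp
qed simp

lemma ideal_sum_monomials: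
  "ideal_sum {p :: 'k::field poly2. Poly_Mapping.keys p \<subseteq> A} {p. Poly_Mapping.keys p \<subseteq> B}
     = {p. Poly_Mapping.keys p \<subseteq> A \<union> B}"
proof (intro equalityI subsetI)
  fix p :: "'k poly2" assume "p \<in> ideal_sum {p. Poly_Mapping.keys p \<subseteq> A} {p. Poly_Mapping.keys p \<subseteq> B}"
  then show "p \<in> {p. Poly_Mapping.keys p \<subseteq> A \<union> B}"
    using keys_add by (fastforce simp: ideal_sum_def)
next
  fix p :: "'k poly2" assume p: "p \<in> {p. Poly_Mapping.keys p \<subseteq> A \<union> B}"
  \<comment> \<open>Split \<open>p\<close> into its terms with exponent in \<open>A\<close> and the remaining ones.\<close>
  define part :: "monom2 set \<Rightarrow> 'k poly2"
    where "part K = (\<Sum>m\<in>K. Poly_Mapping.single m (Poly_Mapping.lookup p m))" for K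
  have keys: "Poly_Mapping.keys (part K) \<subseteq> K" for K
    unfolding part_def using keys_sum[of "\<lambda>m. Poly_Mapping.single m (Poly_Mapping.lookup p m)" K]
    by (auto split: if_splits)
  have "p = part (Poly_Mapping.keys p \<inter> A) + part (Poly_Mapping.keys p - A)"
    unfolding part_def by (subst poly2_expand) (rule sum.Int_Diff, simp)
  moreover have "Poly_Mapping.keys (part (Poly_Mapping.keys p \<inter> A)) \<subseteq> A"
    "Poly_Mapping.keys (part (Poly_Mapping.keys p - A)) \<subseteq> B"
    using keys p by blast+
  ultimately show "p \<in> ideal_sum {p. Poly_Mapping.keys p \<subseteq> A} {p. Poly_Mapping.keys p \<subseteq> B}"
    unfolding ideal_sum_def by blast
qed

lemma E_ideal_eq:
  assumes "is_partition P"
  shows "E_ideal P = {p :: 'k::field poly2. Poly_Mapping.keys p \<subseteq> E_set P}"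
  unfolding E_ideal_def by (rule ideal_gen_monomials) (rule E_set_add_closed[OF assms])

text \<open>
  This turns equations between monomial ideals into equations between sets of exponents.
\<close>

lemma keys_subset_eq_iff:
  "{p :: 'k::field poly2. Poly_Mapping.keys p \<subseteq> A} = {p. Poly_Mapping.keys p \<subseteq> B} \<longleftrightarrow> A = B"
proof
  assume eq: "{p :: 'k poly2. Poly_Mapping.keys p \<subseteq> A} = {p. Poly_Mapping.keys p \<subseteq> B}"
  have "m \<in> A \<longleftrightarrow> m \<in> B" for m
    using eq[THEN eqset_imp_iff, of "poly_of m"] by (simp add: poly_of_def)
  then show "A = B" by blast
qed simp

lemma nth_eq_card_row: "b < length P \<Longrightarrow> P ! b = card {a. (a, b) \<in> C_set P}"
  by (simp add: C_set_def)

lemma length_eq_card_column: "is_partition P \<Longrightarrow> length P = card {b. (0, b) \<in> C_set P}"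
proof -
  assume "is_partition P"
  then have "{b. (0, b) \<in> C_set P} = {..<length P}" by (auto simp: C_set_def is_partition_def)
  then show ?thesis by simp
qed

lemma C_set_inject:
  assumes "is_partition P" "is_partition Q" "C_set P = C_set Q"
  shows "P = Q"
  by (rule nth_equalityI)
     (use assms in \<open>simp_all add: length_eq_card_column nth_eq_card_row\<close>)

lemma down_closed_nat_eq:
  fixes A :: "nat set"
  assumes "finite A" "\<And>a b. a \<in> A \<Longrightarrow> b \<le> a \<Longrightarrow> b \<in> A"
  shows "A = {..<card A}"
proof (cases "A = {}")
  case False
  have "A = {..Max A}" using assms False by (auto intro: Max_ge Max_in)
  then show ?thesis by (metis card_atMost lessThan_Suc_atMost)
qed simp

text \<open>
  Finite sets of monomials closed under divisors are exactly the Ferrers diagrams.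
\<close>

lemma partition_of_down_set:
  assumes fin: "finite C"
    and down: "\<And>a b a' b'. (a, b) \<in> C \<Longrightarrow> a' \<le> a \<Longrightarrow> b' \<le> b \<Longrightarrow> (a', b') \<in> C"
  shows "\<exists>P. is_partition P \<and> C_set P = C"
proof -
  define row where "row b = card {a. (a, b) \<in> C}" for b
  define P where "P = map row [0..<card {b. (0, b) \<in> C}]"
  have finr: "finite {a. (a, b) \<in> C}" for b
    by (rule finite_subset[OF _ finite_imageI[OF fin, of fst]]) force
  have row: "(a, b) \<in> C \<longleftrightarrow> a < row b" for a b
    using down_closed_nat_eq[of "{a. (a, b) \<in> C}"] finr down unfolding row_def by blast
  have "finite {b. (0, b) \<in> C}"
    by (rule finite_subset[OF _ finite_imageI[OF fin, of snd]]) force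
  then have col: "(0, b) \<in> C \<longleftrightarrow> b < length P" for b
    using down_closed_nat_eq[of "{b. (0, b) \<in> C}"] down unfolding P_def by auto
  have "row b \<le> row c" if "c \<le> b" for b c
    unfolding row_def using that by (intro card_mono finr) (auto intro: down)
  moreover have "0 < row b" if "b < length P" for b
    using that row[of 0 b] col[of b] by simp
  ultimately have "is_partition P"
    unfolding is_partition_def sorted_wrt_iff_nth_less by (auto simp: P_def)
  moreover have "C_set P = C"
  proof (rule set_eqI)
    fix m :: monom2
    obtain a b where m: "m = (a, b)" by (cases m)
    have "P ! b = row b" if "b < length P" using that by (simp add: P_def)
    moreover have "b < length P" if "(a, b) \<in> C" using col[of b] down[OF that, of 0 b] by simp
    ultimately show "m \<in> C_set P \<longleftrightarrow> m \<in> C" using row[of a b] by (auto simp: m C_set_def)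
  qed
  ultimately show ?thesis by blast
qed

text \<open>
  A proper multiple of a monomial in \<open>S\<close> already lies in \<open>m^(n + 1)\<close>.
\<close>

lemma ideal_of_top_degree_monomials:
  assumes S: "S \<subseteq> monoms n"
  shows "ideal_sum (ideal_gen (poly_of ` S)) (ideal_power max_ideal (n + 1))
    = {p :: 'k::field poly2. Poly_Mapping.keys p \<subseteq> S \<union> {m. n < deg m}}"
proof -
  have "{m + l | m l. m \<in> S} \<union> {m. n + 1 \<le> deg m} = S \<union> {m. n < deg m}"
  proof (intro equalityI subsetI)
    fix x assume "x \<in> {m + l | m l. m \<in> S} \<union> {m. n + 1 \<le> deg m}"
    moreover have "m + l \<in> S \<or> n < deg (m + l)" if "m \<in> S" for m l
    proof (cases "l = 0")
      case False
      then show ?thesis using that S by (cases l) (auto simp: monoms_def deg_def zero_prod_def)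
    qed (use that in simp)
    ultimately show "x \<in> S \<union> {m. n < deg m}" by (elim UnE) (blast, simp)
  next
    fix x assume x: "x \<in> S \<union> {m. n < deg m}"
    moreover have "x = x + 0" by simp
    ultimately show "x \<in> {m + l | m l. m \<in> S} \<union> {m. n + 1 \<le> deg m}" by fastforce
  qed
  then show ?thesis
    by (simp only: ideal_gen_monomials_upset ideal_power_max_ideal ideal_sum_monomials)
qed

lemma partition_of_top_degree_monomials:
  assumes S: "S \<subseteq> monoms n"
  shows "\<exists>!Q. is_partition Q \<and> (E_ideal Q :: 'k::field poly2 set)
      = ideal_sum (ideal_gen (poly_of ` S)) (ideal_power max_ideal (n + 1))" (is ?ex)
    and "is_partition Q \<Longrightarrow> (E_ideal Q :: 'k::field poly2 set)
      = ideal_sum (ideal_gen (poly_of ` S)) (ideal_power max_ideal (n + 1))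
      \<Longrightarrow> C_set Q = {m. deg m < n} \<union> (monoms n - S)"
proof -
  let ?C = "{m. deg m < n} \<union> (monoms n - S)"
  have iff: "(E_ideal Q :: 'k poly2 set)
      = ideal_sum (ideal_gen (poly_of ` S)) (ideal_power max_ideal (n + 1)) \<longleftrightarrow> C_set Q = ?C"
    if "is_partition Q" for Q
  proof -
    have "- ?C = S \<union> {m. n < deg m}" using S by (auto simp: monoms_def)
    then have "E_set Q = S \<union> {m. n < deg m} \<longleftrightarrow> C_set Q = ?C"
      unfolding E_set_def by (metis double_compl)
    then show ?thesis
      unfolding ideal_of_top_degree_monomials[OF S] E_ideal_eq[OF that] keys_subset_eq_iff .
  qed
  have "finite ?C"
    by (rule finite_subset[of _ "\<Union> (monoms ` {..n})"]) (auto simp: finite_monoms, auto simp: monoms_def)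
  moreover have "(a', b') \<in> ?C" if "(a, b) \<in> ?C" "a' \<le> a" "b' \<le> b" for a b a' b'
  proof -
    have "(a', b') = (a, b) \<or> deg (a', b') < n"
      using that by (auto simp: deg_def monoms_def)
    then show ?thesis using that(1) by blast
  qed
  ultimately obtain Q where Q: "is_partition Q" "C_set Q = ?C"
    using partition_of_down_set[of ?C] by blast
  show ?ex
  proof (rule ex1I[of _ Q])
    show "is_partition Q \<and> (E_ideal Q :: 'k poly2 set)
        = ideal_sum (ideal_gen (poly_of ` S)) (ideal_power max_ideal (n + 1))"
      using Q iff by blast
    show "Q' = Q" if "is_partition Q' \<and> (E_ideal Q' :: 'k poly2 set)
        = ideal_sum (ideal_gen (poly_of ` S)) (ideal_power max_ideal (n + 1))" for Q'
      using that Q iff C_set_inject by metis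
  qed
  show "C_set Q = ?C" if "is_partition Q" "(E_ideal Q :: 'k poly2 set)
      = ideal_sum (ideal_gen (poly_of ` S)) (ideal_power max_ideal (n + 1))" for Q
    using iff that by blast
qed

section \<open>The component partition\<close>

text \<open>
  When all monomials of degree less than \<open>n\<close> and none of degree greater than \<open>n\<close> are cells, each
  degree-\<open>n\<close> cell is a hand, and each degree-\<open>n\<close> non-cell except possibly \<open>x^n\<close> is on the
  horizontal border. The monomial \<open>x^n\<close> is below no other of its degree, so counting \<open>S\<close> instead
  of the border is harmless.
\<close>

lemma hook_block_top_degree:
  assumes Q: "is_partition Q" and C: "C_set Q = {m. deg m < n} \<union> (monoms n - S)" and S: "S \<subseteq> monoms n"
  shows "hook_block k Q n = map (\<lambda>\<nu>. card {m \<in> S. lex_less \<nu> m}) (lex_list (monoms n - S))"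
proof -
  have hands: "hand_monoms Q n = monoms n - S"
    by (auto simp: hand_monoms_def E_set_def C monoms_def deg_def)
  have border: "horizontal_border Q n = {m \<in> S. 0 < snd m}"
    using S by (auto simp: horizontal_border_def E_set_def C monoms_def deg_def)
  have "C_set Q \<inter> monoms n = monoms n - S" "C_set Q \<inter> monoms (n + 1) = {}"
    by (auto simp: C monoms_def)
  then have "delta k Q (n + 1) = card (monoms n - S)"
    by (simp add: delta_def diag_lengths_eq_card[OF Q])
  then have "first_hands k Q n = lex_list (monoms n - S)"
    by (simp add: first_hands_def hands length_lex_list[of _ n])
  moreover have "hook_count Q \<nu> = card {m \<in> S. lex_less \<nu> m}" if "\<nu> \<in> monoms n - S" for \<nu>
  proof -
    have "{m \<in> horizontal_border Q n. lex_less \<nu> m} = {m \<in> S. lex_less \<nu> m}"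
      by (auto simp: border lex_less_def)
    then show ?thesis using hook_count_eq_card_border_below[OF Q, of \<nu> n] that by (simp add: hands)
  qed
  ultimately show ?thesis by (simp add: hook_block_def set_lex_list[of _ n])
qed

text \<open>
  The two hypotheses on the diagonal lengths provide the extra element of \<open>V1\<close> and make the
  truncated subtraction in \<open>delta\<close> exact, which gives \<open>V1\<close> and \<open>V2\<close> together exactly as many
  elements as the diagonal of degree \<open>comp_degree k P i\<close>.
\<close>

lemma hook_block_component:
  fixes k :: "'k::field itself"
  assumes P: "is_partition P" and i: "1 \<le> i" and ne: "diag_lengths k P (i - 1) \<noteq> 0"
    and dec: "diag_lengths k P i \<le> diag_lengths k P (i - 1)"
  shows "hook_block k (component k P i) (comp_degree k P i) = hook_block k P i"
proof -
  define n where "n = comp_degree k P i"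
  define s where "s = comp_bij k P i"
  define Q where "Q = component k P i"
  let ?M = "V1 P i \<union> V2 k P i"
  have ne': "C_set P \<inter> monoms (i - 1) \<noteq> {}"
    using ne unfolding diag_lengths_eq_card[OF P] by (metis card.empty)
  note V1 = V1_subset[OF P ne' i]
  have V2: "V2 k P i \<subseteq> monoms i \<inter> C_set P"
    using V2_subset[of k P i] by (auto simp: hand_monoms_def)
  have M: "?M \<subseteq> monoms i" and disj: "V1 P i \<inter> V2 k P i = {}"
    using V1 V2 by (auto simp: E_set_def)
  have "card (V1 P i) = delta k P i + 1"
    using card_V1[OF P ne' i] dec by (simp add: delta_def diag_lengths_eq_card[OF P])
  then have "card ?M = n + 1"
    using M disj finite_subset_monoms[of _ i]
    by (simp add: card_Un_disjoint card_V2[OF P] n_def comp_degree_def)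
  from theI'[OF order_bij_ex1[OF M this]]
  have bij: "bij_betw s ?M (monoms n)" and mono: "monotone_on ?M lex_less lex_less s"
    by (simp_all add: s_def comp_bij_def n_def)
  define S where "S = s ` V1 P i"
  have inj: "inj_on s ?M" and img: "s ` ?M = monoms n"
    using bij by (simp_all add: bij_betw_def)
  have S: "S \<subseteq> monoms n" using img by (auto simp: S_def)
  have compl: "monoms n - S = s ` V2 k P i"
    using inj_on_image_set_diff[OF inj, of ?M "V1 P i"] img disj by (simp add: S_def Un_Diff Diff_triv Int_commute)
  note ex1 = partition_of_top_degree_monomials(1)[OF S, where 'k = 'k]
  have "Q = (THE Q. is_partition Q \<and> (E_ideal Q :: 'k poly2 set)
      = ideal_sum (ideal_gen (poly_of ` S)) (ideal_power max_ideal (n + 1)))"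
    by (simp add: Q_def component_def S_def s_def n_def)
  then have Q: "is_partition Q" and EQ: "(E_ideal Q :: 'k poly2 set)
      = ideal_sum (ideal_gen (poly_of ` S)) (ideal_power max_ideal (n + 1))"
    using theI'[OF ex1] by simp_all
  have "hook_block k Q n = map (\<lambda>\<nu>. card {m \<in> S. lex_less \<nu> m}) (lex_list (s ` V2 k P i))"
    using hook_block_top_degree[OF Q partition_of_top_degree_monomials(2)[OF S Q EQ] S, of k] compl by simp
  also have "lex_list (s ` V2 k P i) = map s (first_hands k P i)"
    unfolding lex_list_V2[symmetric]
    by (rule lex_list_map[of _ i _ n])
       (use M compl mono in \<open>auto intro: monotone_on_subset\<close>)
  also have "map (\<lambda>\<nu>. card {m \<in> S. lex_less \<nu> m}) (map s (first_hands k P i)) = map (hook_count P) (first_hands k P i)"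
  proof (simp, rule ballI)
    fix \<nu> assume "\<nu> \<in> set (first_hands k P i)"
    then have \<nu>: "\<nu> \<in> V2 k P i" by (simp add: V2_def)
    have "{m \<in> S. lex_less (s \<nu>) m} = s ` {m \<in> V1 P i. lex_less \<nu> m}"
      using lex_less_mono_iff[OF M mono, of \<nu>] \<nu> by (auto simp: S_def)
    also have "card \<dots> = card {m \<in> V1 P i. lex_less \<nu> m}"
      by (intro card_image inj_on_subset[OF inj]) auto
    also have "\<dots> = hook_count P \<nu>"
      using hook_count_eq_card_V1_below[OF P ne' i, of \<nu>] \<nu> V2_subset[of k P i] by auto
    finally show "card {m \<in> S. lex_less (s \<nu>) m} = hook_count P \<nu>" .
  qed
  finally show ?thesis by (simp add: Q_def n_def hook_block_def)
qed

theorem proposition2p22: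
  fixes k :: "'k::field itself"
    and d j i :: nat and t :: "nat \<Rightarrow> nat" and P :: "nat list"
  assumes "t d \<le> d"
    and "\<And>n. d \<le> n \<Longrightarrow> n < j \<Longrightarrow> t (n + 1) \<le> t n"
    and "0 < t j"
    and "is_partition P"
    and "diag_lengths k P = T_seq d j t"
    and "i \<in> {d..j}"
  shows "hook_code k (comp_degree k P i) (comp_degree k P i) (component k P i)
       = [hook_code k d j P ! (i - d)]"
proof -
  have i: "d \<le> i" "i \<le> j" using assms(6) by simp_all
  have mono: "t n \<le> t m" if "d \<le> m" "m \<le> n" "n \<le> j" for m n
    using that(2,3)
  proof (induction n rule: dec_induct)
    case (step n)
    then show ?case using assms(2)[of n] that(1) by simp
  qed simp
  have pos: "0 < t n" if "d \<le> n" "n \<le> j" for n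
    using mono[of n j] that assms(3) by simp
  have d: "0 < d" using pos[of d] assms(1) i by simp
  have "diag_lengths k P (i - 1) \<noteq> 0" "diag_lengths k P i \<le> diag_lengths k P (i - 1)"
  proof -
    show "diag_lengths k P (i - 1) \<noteq> 0"
      using pos[of "i - 1"] i by (auto simp: assms(5) T_seq_def)
    show "diag_lengths k P i \<le> diag_lengths k P (i - 1)"
    proof (cases "i = d")
      case True
      then show ?thesis using d i assms(1) by (simp add: assms(5) T_seq_def)
    next
      case False
      then have "d \<le> i - 1" "i - 1 \<le> j" using i by simp_all
      then show ?thesis using i d mono[of "i - 1" i] by (simp add: assms(5) T_seq_def)
    qed
  qed
  then have "hook_block k (component k P i) (comp_degree k P i) = hook_block k P i"
    using hook_block_component[OF assms(4), of i k] d i by simp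
  moreover have "hook_code k d j P ! (i - d) = hook_block k P i"
    using i by (simp add: hook_code_def del: upt_Suc)
  ultimately show ?thesis by (simp add: hook_code_def)
qed

end
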